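(* Let $n\ge 2$, let $P_n$ be the polycyclic monoid on $A=\{a_1,\dots,a_n\}$, and let $\alpha$ be an endomorphism of $P_n$. Then either: (1) $\alpha$ is a constant map to some idempotent of $P_n$; or (2) $0\alpha=0$ and $\alpha$ maps $u^{-1}v\mapsto(u\phi)^{-1}(v\phi)$ for all $u,v\in A^*$, where $\phi:A^*\to A^*$ is of the form $u\phi=(u\sigma)w$ for some $w\in A^*$ and some injective monoid endomorphism $\sigma:A^*\to A^*$ such that $A\sigma$ is a suffix code.
   Context: Functions are written on the right. $A^*$ is the free monoid on $A$. The polycyclic monoid $P_n$ is the inverse monoid with zero presented by $\langle A: a_ia_i^{-1}=1,\ a_ia_j^{-1}=0\ (i\ne j)\rangle$; its non-zero elements are uniquely of the form $u^{-1}v$ with $u,v\in A^*$ (the paper writes $(u,v)$ for $u^{-1}v$). An endomorphism of $P_n$ is a function $\alpha:P_n\to P_n$ with $(xy)\alpha=(x\alpha)(y\alpha)$ for all $x,y$ (not required to preserve $0$ or $1$). A suffix code is a set of non-empty words none of which is a proper suffix of another. *)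

theory Defs
  imports Main "HOL-Library.Sublist"
begin

section \<open>Presentations of inverse monoids with zero\<close>

text \<open>
  A word over \<open>A \<union> A\<inverse>\<close> is a list over \<open>'a + 'a\<close>, where \<open>Inl a\<close> stands for the letter \<open>a\<close>
  and \<open>Inr a\<close> for its formal inverse. Words together with an adjoined zero (\<open>None\<close>)
  form the free monoid with involution and zero on \<open>A\<close>.
\<close>

type_synonym 'a iword = "('a + 'a) list option"

fun wmul :: "'a iword \<Rightarrow> 'a iword \<Rightarrow> 'a iword" where
  "wmul (Some u) (Some v) = Some (u @ v)"
| "wmul None _ = None"
| "wmul _ None = None"

definition winv :: "'a iword \<Rightarrow> 'a iword" where
  "winv = map_option (\<lambda>u. rev (map (case_sum Inr Inl) u))"

lemma wmul_None_right [simp]: "wmul p None = None"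
  by (cases p) auto

lemma wmul_assoc: "wmul (wmul p q) r = wmul p (wmul q r)"
  by (cases p; cases q; cases r) auto

lemma wmul_one [simp]: "wmul (Some []) p = p" "wmul p (Some []) = p"
  by (cases p; simp)+

text \<open>
  The congruence defining the inverse monoid with zero presented by the relations \<open>p = q\<close>
  for \<open>(p, q) \<in> R\<close>. The rules \<open>regular\<close> and \<open>commute\<close> are the identities defining inverse
  monoids as algebras with a multiplication, an inversion and an identity.
\<close>

inductive inv_cong :: "('a iword \<times> 'a iword) set \<Rightarrow> 'a iword \<Rightarrow> 'a iword \<Rightarrow> bool"
  for R where
  rel: "(p, q) \<in> R \<Longrightarrow> inv_cong R p q"
| regular: "inv_cong R (wmul (wmul p (winv p)) p) p"
| commute: "inv_cong R (wmul (wmul p (winv p)) (wmul q (winv q)))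
                       (wmul (wmul q (winv q)) (wmul p (winv p)))"
| refl: "inv_cong R p p"
| sym: "inv_cong R p q \<Longrightarrow> inv_cong R q p"
| trans: "inv_cong R p q \<Longrightarrow> inv_cong R q r \<Longrightarrow> inv_cong R p r"
| mult: "inv_cong R p p' \<Longrightarrow> inv_cong R q q' \<Longrightarrow> inv_cong R (wmul p q) (wmul p' q')"
| inv: "inv_cong R p q \<Longrightarrow> inv_cong R (winv p) (winv q)"

section \<open>The polycyclic monoid\<close>

definition polycyclic_rels :: "('a iword \<times> 'a iword) set" where
  "polycyclic_rels =
     {(Some [Inl a, Inr a], Some []) | a. True} \<union>
     {(Some [Inl a, Inr b], None) | a b. a \<noteq> b}"

quotient_type 'a polycyclic = "'a iword" / "inv_cong (polycyclic_rels :: ('a iword \<times> 'a iword) set)"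
  by (rule equivpI; unfold reflp_def symp_def transp_def; blast intro: inv_cong.intros)

instantiation polycyclic :: (type) "{monoid_mult, mult_zero}"
begin

lift_definition times_polycyclic :: "'a polycyclic \<Rightarrow> 'a polycyclic \<Rightarrow> 'a polycyclic"
  is wmul by (rule inv_cong.mult)

lift_definition one_polycyclic :: "'a polycyclic" is "Some []" .

lift_definition zero_polycyclic :: "'a polycyclic" is None .

instance
  by standard (transfer; simp add: wmul_assoc inv_cong.refl)+

end

lift_definition pinv :: "'a polycyclic \<Rightarrow> 'a polycyclic" is winv
  by (rule inv_cong.inv)

lift_definition pword :: "'a list \<Rightarrow> 'a polycyclic" is "\<lambda>u. Some (map Inl u)" .

lemma pword_Nil: "pword [] = 1"
  by transfer (simp add: inv_cong.refl)

lemma pword_append: "pword (u @ v) = pword u * pword v"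
  by transfer (simp add: inv_cong.refl)

lemma polycyclic_rel_eq: "pword [a] * pinv (pword [a]) = 1"
  by transfer (auto simp: winv_def polycyclic_rels_def intro: inv_cong.rel)

lemma polycyclic_rel_neq: "a \<noteq> b \<Longrightarrow> pword [a] * pinv (pword [b]) = 0"
  by transfer (auto simp: winv_def polycyclic_rels_def intro: inv_cong.rel)

section \<open>Words\<close>

definition monoid_endo :: "('a list \<Rightarrow> 'a list) \<Rightarrow> bool" where
  "monoid_endo \<sigma> \<longleftrightarrow> \<sigma> [] = [] \<and> (\<forall>u v. \<sigma> (u @ v) = \<sigma> u @ \<sigma> v)"

definition suffix_code :: "'a list set \<Rightarrow> bool" where
  "suffix_code C \<longleftrightarrow> [] \<notin> C \<and> (\<forall>u\<in>C. \<forall>v\<in>C. \<not> strict_suffix u v)"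

end

theory Submission
  imports Defs
begin

text \<open>
  Sending \<open>a\<close> to the partial injection \<open>s \<mapsto> s @ [a]\<close> of \<open>A\<^sup>*\<close> separates the elements
  \<open>u\<inverse>v\<close>, so products in the polycyclic monoid can be compared through their normal forms.
  Let \<open>e\<close> be the image of \<open>0\<close>. If \<open>e \<noteq> 0\<close>, every image lies above \<open>e\<close> and is
  therefore idempotent; images thus commute, so \<open>aa\<inverse>\<close> and \<open>a\<inverse>a\<close> have the same image, and
  \<open>b = b(aa\<inverse>)\<close> has the image of \<open>b(a\<inverse>a) = 0\<close>, which makes the endomorphism constant.
  If \<open>e = 0\<close> and \<open>1\<close> is mapped to \<open>w\<inverse>w\<close>, the image of \<open>aa\<inverse> = 1\<close> forces
  \<open>a \<mapsto> w\<inverse>(tw)\<close> and \<open>a\<inverse> \<mapsto> (tw)\<inverse>w\<close> for some word \<open>t\<close> depending on \<open>a\<close>, and the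
  relations \<open>ab\<inverse> = 0\<close> say that these words are pairwise incomparable for the suffix order.
\<close>

section \<open>Normal forms in the polycyclic monoid\<close>

fun letter_rel :: "'a + 'a \<Rightarrow> 'a list rel" where
  "letter_rel (Inl a) = {(s, s @ [a]) | s. True}"
| "letter_rel (Inr a) = {(s @ [a], s) | s. True}"

fun word_rel :: "('a + 'a) list \<Rightarrow> 'a list rel" where
  "word_rel [] = Id"
| "word_rel (x # w) = letter_rel x O word_rel w"

fun iword_rel :: "'a iword \<Rightarrow> 'a list rel" where
  "iword_rel None = {}"
| "iword_rel (Some w) = word_rel w"

lemma word_rel_append: "word_rel (u @ v) = word_rel u O word_rel v"
  by (induction u) (auto simp: O_assoc)

lemma iword_rel_wmul: "iword_rel (wmul p q) = iword_rel p O iword_rel q"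
  by (cases p; cases q) (auto simp: word_rel_append)

lemma letter_rel_inverse: "letter_rel (case_sum Inr Inl x) = (letter_rel x)\<inverse>"
  by (cases x) auto

lemma word_rel_inverse: "word_rel (rev (map (case_sum Inr Inl) w)) = (word_rel w)\<inverse>"
  by (induction w) (auto simp: word_rel_append letter_rel_inverse converse_relcomp)

lemma iword_rel_winv: "iword_rel (winv p) = (iword_rel p)\<inverse>"
  by (cases p) (auto simp: winv_def word_rel_inverse)

lemma single_valued_letter_rel: "single_valued (letter_rel x)"
  by (cases x) (auto simp: single_valued_def)

lemma single_valued_iword_rel: "single_valued (iword_rel p)"
proof (cases p)
  case (Some w)
  have "single_valued (word_rel w)"
    by (induction w) (auto intro: single_valued_relcomp single_valued_letter_rel)
  with Some show ?thesis by simp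
qed simp

lemma single_valued_converse_iword_rel: "single_valued ((iword_rel p)\<inverse>)"
  using single_valued_iword_rel[of "winv p"] by (simp add: iword_rel_winv)

text \<open>Partial injections form an inverse monoid under \<open>O\<close>: \<open>regular\<close>
  uses single-valuedness, and \<open>commute\<close> holds because injectivity makes each
  \<open>R O R\<inverse>\<close> a partial identity. Appending \<open>a\<close> and then removing
  \<open>b\<close> is the identity if \<open>a = b\<close> and empty otherwise.\<close>

lemma iword_rel_cong: "inv_cong polycyclic_rels p q \<Longrightarrow> iword_rel p = iword_rel q"
proof (induction rule: inv_cong.induct)
  case (rel p q)
  then show ?case by (auto simp: polycyclic_rels_def relcomp_unfold)
next
  case (regular p)
  show ?case using single_valued_iword_rel[of p]
    by (auto simp: iword_rel_wmul iword_rel_winv single_valued_def)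
next
  case (commute p q)
  have *: "iword_rel r O (iword_rel r)\<inverse> \<subseteq> Id" for r :: "'a iword"
    using single_valued_converse_iword_rel[of r] by (auto simp: single_valued_def)
  have "R O S = S O R" if "R \<subseteq> Id" "S \<subseteq> Id" for R S :: "'a list rel"
    using that by blast
  from this[OF * *] show ?case by (simp only: iword_rel_wmul iword_rel_winv)
qed (auto simp: iword_rel_wmul iword_rel_winv)

lift_definition pol_rel :: "'a polycyclic \<Rightarrow> 'a list rel" is iword_rel
  by (rule iword_rel_cong)

lemma pol_rel_mult: "pol_rel (x * y) = pol_rel x O pol_rel y"
  by transfer (rule iword_rel_wmul)

lemma pol_rel_pinv: "pol_rel (pinv x) = (pol_rel x)\<inverse>"
  by transfer (rule iword_rel_winv)

lemma pol_rel_0: "pol_rel 0 = {}"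
  by transfer simp

lemma pol_rel_pword: "pol_rel (pword u) = {(s, s @ u) | s. True}"
proof transfer
  fix u :: "'a list"
  have "word_rel (map Inl u) = {(s, s @ u) | s. True}"
    by (induction u) auto
  then show "iword_rel (Some (map Inl u)) = {(s, s @ u) | s. True}" by simp
qed

lemma pinv_mult: "pinv (x * y) = pinv y * pinv x"
proof transfer
  fix x y :: "'a iword"
  have "winv (wmul x y) = wmul (winv y) (winv x)"
    by (cases x; cases y) (auto simp: winv_def)
  then show "inv_cong polycyclic_rels (winv (wmul x y)) (wmul (winv y) (winv x))"
    by (simp add: inv_cong.refl)
qed

lemma pinv_1: "pinv 1 = 1"
  by transfer (simp add: winv_def inv_cong.refl)

section \<open>Normal forms and their products\<close>

definition nf :: "'a list \<Rightarrow> 'a list \<Rightarrow> 'a polycyclic" where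
  "nf u v = pinv (pword u) * pword v"

lemma pol_rel_nf: "pol_rel (nf u v) = {(s @ u, s @ v) | s. True}"
  unfolding nf_def pol_rel_mult pol_rel_pinv pol_rel_pword by blast

lemma nf_neq_0: "nf u v \<noteq> 0"
proof
  assume "nf u v = 0"
  then have "pol_rel (nf u v) = {}" by (simp add: pol_rel_0)
  then show False unfolding pol_rel_nf by blast
qed

text \<open>The relation of \<open>nf u v\<close> contains \<open>(u, v)\<close> itself, so equal
  relations make each pair a common left extension of the other; both extensions are then
  empty.\<close>

lemma nf_eq_iff: "nf u v = nf x y \<longleftrightarrow> u = x \<and> v = y"
proof
  assume "nf u v = nf x y"
  then have eq: "{(s @ u, s @ v) | s. True} = {(s @ x, s @ y) | s. True}"
    by (metis pol_rel_nf)
  have "(u, v) \<in> {(s @ u, s @ v) | s. True}" by force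
  then obtain s where s: "u = s @ x" "v = s @ y" unfolding eq by blast
  have "(x, y) \<in> {(s @ x, s @ y) | s. True}" by force
  then obtain t where "x = t @ u" "y = t @ v" unfolding eq[symmetric] by blast
  with s show "u = x \<and> v = y" by simp
qed simp

text \<open>The last letters of \<open>v\<close> and \<open>x\<close> meet in the middle: equal ones
  cancel to 1, different ones give 0. If one word is used up, the remaining prefix of the other
  survives.\<close>

lemma pword_mult_pinv_cases:
  obtains (left) s where "v = s @ x" "pword v * pinv (pword x) = pword s"
  | (right) s where "x = s @ v" "pword v * pinv (pword x) = pinv (pword s)"
  | (zero) "\<not> suffix x v" "\<not> suffix v x" "pword v * pinv (pword x) = 0"
proof -
  have "(\<exists>s. v = s @ x \<and> pword v * pinv (pword x) = pword s) \<or>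
     (\<exists>s. x = s @ v \<and> pword v * pinv (pword x) = pinv (pword s)) \<or>
     (\<not> suffix x v \<and> \<not> suffix v x \<and> pword v * pinv (pword x) = 0)"
  proof (induction v arbitrary: x rule: rev_induct)
    case Nil
    then show ?case by (simp add: pword_Nil)
  next
    case (snoc a v)
    show ?case
    proof (cases x rule: rev_cases)
      case Nil
      then show ?thesis by (simp add: pword_Nil pinv_1)
    next
      case (snoc y b)
      have eq: "pword (v @ [a]) * pinv (pword x) =
        pword v * (pword [a] * pinv (pword [b])) * pinv (pword y)"
        by (simp add: snoc pword_append pinv_mult mult.assoc)
      show ?thesis
      proof (cases "a = b")
        case True
        with eq have "pword (v @ [a]) * pinv (pword x) = pword v * pinv (pword y)"
          by (simp add: polycyclic_rel_eq)
        with snoc.IH[of y] show ?thesis by (simp add: snoc True)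
      next
        case False
        with eq have "pword (v @ [a]) * pinv (pword x) = 0"
          by (simp add: polycyclic_rel_neq)
        with False show ?thesis by (simp add: snoc)
      qed
    qed
  qed
  then show ?thesis using that by blast
qed

lemma nf_mult_cases:
  obtains (left) s where "v = s @ x" "nf u v * nf x y = nf u (s @ y)"
  | (right) s where "x = s @ v" "nf u v * nf x y = nf (s @ u) y"
  | (zero) "\<not> suffix x v" "\<not> suffix v x" "nf u v * nf x y = 0"
proof -
  have eq: "nf u v * nf x y = pinv (pword u) * (pword v * pinv (pword x)) * pword y"
    by (simp add: nf_def mult.assoc)
  show ?thesis
  proof (cases rule: pword_mult_pinv_cases[of v x])
    case (left s)
    from eq[unfolded this(2)] have "nf u v * nf x y = nf u (s @ y)"
      by (simp add: nf_def pword_append mult.assoc)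
    with left that show ?thesis by blast
  next
    case (right s)
    from eq[unfolded this(2)] have "nf u v * nf x y = nf (s @ u) y"
      by (simp add: nf_def pword_append pinv_mult mult.assoc)
    with right that show ?thesis by blast
  next
    case zero
    with eq that show ?thesis by simp
  qed
qed

lemma nf_mult_left: "nf u (s @ x) * nf x y = nf u (s @ y)"
  by (cases rule: nf_mult_cases[of "s @ x" x u y]) (auto simp: suffix_def)

lemma nf_mult_right: "nf u v * nf (s @ v) y = nf (s @ u) y"
  by (cases rule: nf_mult_cases[of v "s @ v" u y]) (auto simp: suffix_def)

text \<open>Zero and the normal forms are closed under left multiplication by a letter, which is
  itself a normal form, and by an inverse letter, which only extends the first component.\<close>

lemma polycyclic_cases:
  obtains "x = 0" | u v where "x = nf u v"
proof -
  have letter: "pword [a] * nf u v = 0 \<or> (\<exists>u' v'. pword [a] * nf u v = nf u' v')"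
    for a :: 'a and u v
  proof -
    have "pword [a] = nf [] [a]" by (simp add: nf_def pword_Nil pinv_1)
    then show ?thesis by (metis nf_mult_cases)
  qed
  have "x = 0 \<or> (\<exists>u v. x = nf u v)"
  proof (induction x rule: polycyclic.abs_induct)
    case (1 p)
    show ?case
    proof (cases p)
      case None
      then show ?thesis by (simp add: zero_polycyclic.abs_eq)
    next
      case (Some w)
      have "abs_polycyclic (Some w) = 0 \<or> (\<exists>u v. abs_polycyclic (Some w) = nf u v)"
      proof (induction w)
        case Nil
        have "abs_polycyclic (Some []) = nf [] []"
          by (simp add: nf_def pword_Nil pinv_1 flip: one_polycyclic.abs_eq)
        then show ?case by blast
      next
        case (Cons l w)
        show ?case
        proof (cases l)
          case (Inl a)
          have "abs_polycyclic (Some (l # w)) = pword [a] * abs_polycyclic (Some w)"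
            by (simp add: Inl pword.abs_eq times_polycyclic.abs_eq)
          with Cons.IH letter[of a] show ?thesis by (metis mult_zero_right)
        next
          case (Inr a)
          have "abs_polycyclic (Some (l # w)) = pinv (pword [a]) * abs_polycyclic (Some w)"
            by (simp add: Inr pword.abs_eq pinv.abs_eq times_polycyclic.abs_eq winv_def)
          moreover have "pinv (pword [a]) * nf u v = nf (u @ [a]) v" for u v
            by (simp add: nf_def pword_append pinv_mult mult.assoc)
          ultimately show ?thesis using Cons.IH by (metis mult_zero_right)
        qed
      qed
      with Some show ?thesis by simp
    qed
  qed
  then show ?thesis using that by blast
qed

section \<open>Idempotents and the elements they fix\<close>

lemma idempotent_cases:
  assumes "e * e = e"
  obtains "e = 0" | w where "e = nf w w"
proof (cases e rule: polycyclic_cases)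
  case (2 u v)
  have "u = v"
    by (cases rule: nf_mult_cases[of v u u v])
      (use assms 2 in \<open>auto simp: nf_eq_iff nf_neq_0 dest: sym\<close>)
  with 2 that show ?thesis by blast
qed (use that in blast)

lemma idempotents_commute: "nf p p * nf q q = nf q q * nf p p"
proof (cases rule: nf_mult_cases[of p q p q])
  case (left s)
  then show ?thesis by (simp add: nf_mult_right)
next
  case (right s)
  then show ?thesis using nf_mult_left[of "s @ p" s p p] by simp
next
  case zero
  then show ?thesis by (cases rule: nf_mult_cases[of q p q p]) (auto simp: suffix_def)
qed

text \<open>The product is non-zero, so \<open>w\<close> and the second component of
  \<open>x\<close> are suffix-comparable; matching components then makes those of \<open>x\<close>
  equal.\<close>

lemma idempotent_if_above:
  assumes "x * nf w w = nf w w"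
  obtains p where "x = nf p p"
proof (cases x rule: polycyclic_cases)
  case 1
  with assms show ?thesis by (metis mult_zero_left nf_neq_0)
next
  case (2 p q)
  have "p = q"
    by (cases rule: nf_mult_cases[of q w p w]) 
      (use assms 2 nf_neq_0[of w w] in \<open>auto simp: nf_eq_iff\<close>)
  with 2 that show ?thesis by blast
qed

text \<open>Any non-zero product with \<open>nf w w\<close> on the left has a first component ending
  in \<open>w\<close>.\<close>

lemma suffix_if_left_identity:
  assumes "nf w w * nf p q = nf p q"
  shows "suffix w p"
  by (cases rule: nf_mult_cases[of w p w q])
    (use assms nf_neq_0[of p q] in \<open>auto simp: nf_eq_iff suffix_def\<close>)

lemma suffix_if_right_identity:
  assumes "nf p q * nf w w = nf p q"
  shows "suffix w q"
  by (cases rule: nf_mult_cases[of q w p w])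
    (use assms nf_neq_0[of p q] in \<open>auto simp: nf_eq_iff suffix_def\<close>)

text \<open>Used with \<open>x\<close> and \<open>y\<close> the images of a letter and its inverse,
  and \<open>nf w w\<close> the image of 1.\<close>

lemma local_one_sided_inverses:
  assumes "x * y = nf w w" "nf w w * x = x" "x * nf w w = x" "y * nf w w = y"
  obtains t where "x = nf w (t @ w)" "y = nf (t @ w) w"
proof -
  have "x \<noteq> 0" "y \<noteq> 0" using assms(1) nf_neq_0[of w w] by auto
  then obtain p q p' q' where x: "x = nf p q" and y: "y = nf p' q'"
    by (metis polycyclic_cases)
  obtain s where s: "p = s @ w"
    using suffix_if_left_identity[of w p q] assms(2) x by (auto simp: suffix_def)
  obtain r where r: "q' = r @ w"
    using suffix_if_right_identity[of p' q' w] assms(4) y by (auto simp: suffix_def)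
  \<comment> \<open>Multiplication can only lengthen the outer words \<open>p\<close> and
    \<open>q'\<close>, which already end in \<open>w\<close>, so the value \<open>nf w w\<close>
    leaves no remainder in the middle.\<close>
  have *: "p = w \<and> q' = w \<and> q = p'"
    by (cases rule: nf_mult_cases[of q p' p q'])
      (use assms(1) x y s r nf_neq_0[of w w] in \<open>auto simp: nf_eq_iff\<close>)
  then obtain t where "q = t @ w"
    using suffix_if_right_identity[of p q w] assms(3) x by (auto simp: suffix_def)
  with * x y that[of t] show ?thesis by simp
qed


section \<open>Suffix codes\<close>

text \<open>Decoding runs from the right: the final blocks of two equal products are suffixes of one
  word, hence comparable, hence come from the same letter and cancel.\<close>

lemma inj_concat_map_suffix_free:
  fixes t :: "'a \<Rightarrow> 'b list"
  assumes free: "\<And>a b. a \<noteq> b \<Longrightarrow> \<not> suffix (t a) (t b)"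
    and nonempty: "\<And>a. t a \<noteq> []"
  shows "inj (\<lambda>u. concat (map t u))"
proof -
  have "u = v" if "concat (map t u) = concat (map t v)" for u v
    using that
  proof (induction u arbitrary: v rule: rev_induct)
    case Nil
    then show ?case using nonempty by (cases v) auto
  next
    case (snoc a u)
    then show ?case
    proof (cases v rule: rev_cases)
      case Nil
      with snoc.prems nonempty[of a] show ?thesis by simp
    next
      case (snoc v' b)
      with snoc.prems have eq: "concat (map t u) @ t a = concat (map t v') @ t b" by simp
      then have "suffix (t a) (t b) \<or> suffix (t b) (t a)"
        by (metis suffixI suffix_same_cases)
      with free have "a = b" by metis
      with eq snoc.IH[of v'] snoc show ?thesis by simp
    qed
  qed
  then show ?thesis by (rule injI)
qed

section \<open>Endomorphisms\<close>

lemma endo_constant_if_zero_moved: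
  fixes \<alpha> :: "'a polycyclic \<Rightarrow> 'a polycyclic" and a b :: 'a
  assumes hom: "\<And>x y. \<alpha> (x * y) = \<alpha> x * \<alpha> y"
    and "\<alpha> 0 \<noteq> 0" and "a \<noteq> b"
  shows "\<alpha> x = \<alpha> 0"
proof -
  obtain w where w: "\<alpha> 0 = nf w w"
    using idempotent_cases[of "\<alpha> 0"] hom[of 0 0] \<open>\<alpha> 0 \<noteq> 0\<close> by auto
  have "\<exists>p. \<alpha> y = nf p p" for y
    using idempotent_if_above[of "\<alpha> y" w] hom[of y 0] w by auto
  then have comm: "\<alpha> y * \<alpha> z = \<alpha> z * \<alpha> y" for y z
    by (metis idempotents_commute)
  have "\<alpha> 1 = \<alpha> (pinv (pword [a]) * pword [a])"
    using comm hom polycyclic_rel_eq[of a] by metis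
  then have "\<alpha> (pword [b]) = \<alpha> (pword [b] * (pinv (pword [a]) * pword [a]))"
    using hom mult_1_right by metis
  also have "\<dots> = \<alpha> 0"
    using polycyclic_rel_neq[of b a] \<open>a \<noteq> b\<close> by (simp flip: mult.assoc)
  \<comment> \<open>Multiply on the right by the image of \<open>pinv (pword [b])\<close>.\<close>
  finally have "\<alpha> 1 = \<alpha> 0"
    using hom polycyclic_rel_eq[of b] mult_zero_left by metis
  then show ?thesis by (metis hom mult_1_right mult_zero_right)
qed

theorem proposition5p4:
  fixes \<alpha> :: "'a::finite polycyclic \<Rightarrow> 'a polycyclic"
  assumes "card (UNIV :: 'a set) \<ge> 2"
    and "\<And>x y. \<alpha> (x * y) = \<alpha> x * \<alpha> y"
  shows "(\<exists>e. e * e = e \<and> (\<forall>x. \<alpha> x = e)) \<or>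
    (\<alpha> 0 = 0 \<and>
     (\<exists>\<phi> :: 'a list \<Rightarrow> 'a list.
        (\<forall>u v. \<alpha> (pinv (pword u) * pword v) = pinv (pword (\<phi> u)) * pword (\<phi> v)) \<and>
        (\<exists>w \<sigma>. monoid_endo \<sigma> \<and> inj \<sigma> \<and> suffix_code ((\<lambda>a. \<sigma> [a]) ` UNIV) \<and>
           (\<forall>u. \<phi> u = \<sigma> u @ w))))"
proof -
  note hom = assms(2)
  have two: "\<exists>b. b \<noteq> a" for a :: 'a
  proof (rule ccontr)
    assume "\<nexists>b. b \<noteq> a"
    then have "(UNIV :: 'a set) = {a}" by auto
    then have "card (UNIV :: 'a set) = card {a}" by (rule arg_cong)
    with assms(1) show False by simp
  qed
  have one: "\<alpha> x * \<alpha> 1 = \<alpha> x" "\<alpha> 1 * \<alpha> x = \<alpha> x" for x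
    using hom[of x 1] hom[of 1 x] by auto
  show ?thesis
  \<comment> \<open>If 0 and 1 are both sent to 0, then \<alpha> is constantly 0, so this joins the
    constant case.\<close>
  proof (cases "\<alpha> 0 = 0 \<and> \<alpha> 1 \<noteq> 0")
    case False
    have "\<alpha> x = \<alpha> 0" for x
    proof (cases "\<alpha> 0 = 0")
      case True
      with False one(1)[of x] show ?thesis by simp
    next
      case False
      \<comment> \<open>\<open>undefined\<close> stands for an arbitrary first letter.\<close>
      obtain b :: 'a where "b \<noteq> undefined" using two by blast
      with hom False show ?thesis by (rule endo_constant_if_zero_moved)
    qed
    moreover have "\<alpha> 0 * \<alpha> 0 = \<alpha> 0" using hom[of 0 0] by simp
    ultimately show ?thesis by blast
  next
    case True
    then obtain w where w: "\<alpha> 1 = nf w w"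
      using idempotent_cases[of "\<alpha> 1"] one(1)[of 1] by auto
    have "\<exists>t. \<alpha> (pword [a]) = nf w (t @ w) \<and> \<alpha> (pinv (pword [a])) = nf (t @ w) w" for a
    proof -
      have "\<alpha> (pword [a]) * \<alpha> (pinv (pword [a])) = nf w w"
        using hom[of "pword [a]" "pinv (pword [a])"] by (simp add: polycyclic_rel_eq w)
      from local_one_sided_inverses[OF this one(2,1,1)[unfolded w]] show ?thesis by blast
    qed
    then obtain t where t: "\<And>a. \<alpha> (pword [a]) = nf w (t a @ w)"
      "\<And>a. \<alpha> (pinv (pword [a])) = nf (t a @ w) w"
      by metis
    have free: "\<not> suffix (t a) (t b)" if "a \<noteq> b" for a b
    proof
      assume "suffix (t a) (t b)"
      then obtain s where s: "t b = s @ t a" by (auto simp: suffix_def)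
      have "nf w (t a @ w) * nf (t b @ w) w = 0"
        using hom[of "pword [a]" "pinv (pword [b])"] polycyclic_rel_neq[OF that] t True by simp
      \<comment> \<open>The product that should vanish equals the normal form
        \<open>nf (s @ w) w\<close>.\<close>
      then show False using nf_mult_right[of w "t a @ w" s w] by (simp add: s nf_neq_0)
    qed
    \<comment> \<open>An empty \<open>t a\<close> would be a suffix of \<open>t b\<close> for a
      second letter \<open>b\<close>.\<close>
    have nonempty: "t a \<noteq> []" for a
      using two[of a] free by (metis Nil_suffix)
    \<comment> \<open>This is the extension of \<open>t\<close> to words. In the products below,
      adjacent inner copies of \<open>w\<close> cancel, so only the outer copies remain.\<close>
    define \<sigma> where "\<sigma> u = concat (map t u)" for u
    have pos: "\<alpha> (pword u) = nf w (\<sigma> u @ w)" for u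
    proof (induction u)
      case (Cons a u)
      have "\<alpha> (pword (a # u)) = \<alpha> (pword [a]) * \<alpha> (pword u)"
        using hom pword_append[of "[a]" u] by simp
      then show ?case by (simp add: Cons.IH t nf_mult_left \<sigma>_def)
    qed (simp add: pword_Nil w \<sigma>_def)
    have neg: "\<alpha> (pinv (pword u)) = nf (\<sigma> u @ w) w" for u
    proof (induction u)
      case (Cons a u)
      have "\<alpha> (pinv (pword (a # u))) = \<alpha> (pinv (pword u)) * \<alpha> (pinv (pword [a]))"
        using hom pword_append[of "[a]" u] by (simp add: pinv_mult)
      then show ?case by (simp add: Cons.IH t nf_mult_right \<sigma>_def)
    qed (simp add: pword_Nil pinv_1 w \<sigma>_def)
    have "\<alpha> (nf u v) = nf (\<sigma> u @ w) (\<sigma> v @ w)" for u v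
      using hom[of "pinv (pword u)" "pword v"] nf_mult_left[of "\<sigma> u @ w" "[]" w "\<sigma> v @ w"]
      by (simp add: nf_def[of u v] pos neg)
    moreover have "monoid_endo \<sigma>" by (simp add: monoid_endo_def \<sigma>_def)
    moreover have "inj \<sigma>"
      unfolding \<sigma>_def using free nonempty by (rule inj_concat_map_suffix_free)
    moreover have "suffix_code ((\<lambda>a. \<sigma> [a]) ` UNIV)"
      unfolding suffix_code_def
    proof (intro conjI ballI)
      show "[] \<notin> (\<lambda>a. \<sigma> [a]) ` UNIV" using nonempty[symmetric] by (auto simp: \<sigma>_def)
    next
      fix u v assume "u \<in> (\<lambda>a. \<sigma> [a]) ` UNIV" "v \<in> (\<lambda>a. \<sigma> [a]) ` UNIV"
      then obtain a b where "u = t a" "v = t b" by (auto simp: \<sigma>_def)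
      \<comment> \<open>Strictness excludes \<open>a = b\<close>; \<open>free\<close> covers
        distinct letters.\<close>
      then show "\<not> strict_suffix u v" using free[of a b] by (auto simp: strict_suffix_def)
    qed
    ultimately show ?thesis
      using True unfolding nf_def
      by (intro disjI2 conjI exI[of _ "\<lambda>u. \<sigma> u @ w"] exI[of _ w] exI[of _ \<sigma>]) auto
  qed
qed

end
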